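(* Consider the following Markov decision process with a single action (so there is a single policy), built from the sequences $\varepsilon^{(n)}$, $N(n)$, $n=1,2,\ldots$, defined in the context from an arbitrary $\alpha^{(1)}\in[\frac12,1)$. The state space is $\mathbb{X}:=\{0\}\cup\{(n,k): n=1,2,\ldots,\ k=1,2,\ldots,2N(n)\}$; the transition probabilities are $q(0|0):=1$, $q(0|(n,2N(n))):=1$, and $q((n,k+1)|(n,k)):=1$ for $n=1,2,\ldots$ and $k=1,2,\ldots,2N(n)-1$; the one-step costs are $c(0):=1$, $c(n,k):=1-\varepsilon^{(n)}$ for $k=1,\ldots,N(n)$, and $c(n,k):=1+\varepsilon^{(n)}$ for $k=N(n)+1,\ldots,2N(n)$, $n=1,2,\ldots$. This process satisfies Assumption $\underline{\rm B}$, namely $\liminf_{\alpha\uparrow1}u_\alpha(x)<+\infty$ for all $x\in\mathbb{X}$, but it does not satisfy Assumption ${\rm B}$, namely it is not true that $\sup_{\alpha\in[0,1)}u_\alpha(x)<+\infty$ for all $x\in\mathbb{X}$.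
   Context: For $\beta\in(0,1)$ and $M>0$ define $$\varepsilon_\beta:=1-\beta,\qquad \gamma_{\beta,M}:=\max\Big\{\tfrac{\beta+1}{2},\,1-\tfrac{\varepsilon_\beta}{3M}\Big\}\in(\beta,1),$$ $$n^*_{\beta,M}:=\Big\lfloor\log_{\gamma_{\beta,M}}\Big(\min\Big\{\tfrac12,\tfrac{M(1-\gamma_{\beta,M})}{\varepsilon_\beta}\Big\}\Big)\Big\rfloor+1\ge1,$$ $$\delta_{\beta,M}:=\max\Big\{\tfrac{\gamma_{\beta,M}+1}{2},\,\Big(1-\tfrac{1}{\varepsilon_\beta n^*_{\beta,M}}\Big)^{1/n^*_{\beta,M}}\Big\}\in(\gamma_{\beta,M},1),$$ where $\lfloor\cdot\rfloor$ is the integer part of a number. Choose an arbitrary $\alpha^{(1)}\in[\frac12,1)$, and for $n=1,2,\ldots$ set $\varepsilon^{(n)}:=\varepsilon_{\alpha^{(n)}}$, $N(n):=n^*_{\alpha^{(n)},n}$, and $\alpha^{(n+1)}:=\delta_{\alpha^{(n)},n}$. For $\alpha\in[0,1)$, $v_\alpha(x)=\sum_{t=0}^\infty\alpha^tc(x_t)$ is the total discounted cost (with $0^0=1$) along the deterministic trajectory $x_0=x,x_1,x_2,\ldots$ given by the transition probabilities $q$; $m_\alpha=\inf_{x\in\mathbb{X}}v_\alpha(x)$ and $u_\alpha(x)=v_\alpha(x)-m_\alpha$. *)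

theory Defs
  imports "HOL-Probability.Probability"
begin

definition eps_of :: "real \<Rightarrow> real" where
  "eps_of \<beta> = 1 - \<beta>"

definition gamma_of :: "real \<Rightarrow> real \<Rightarrow> real" where
  "gamma_of \<beta> M = max ((\<beta> + 1) / 2) (1 - eps_of \<beta> / (3 * M))"

(* For 0 < \<beta> < 1 and M > 0 the base lies in (0,1) and the argument in (0,1/2], so the
   logarithm is positive and the conversion to nat loses nothing. *)
definition nstar :: "real \<Rightarrow> real \<Rightarrow> nat" where
  "nstar \<beta> M =
     nat \<lfloor>log (gamma_of \<beta> M) (min (1 / 2) (M * (1 - gamma_of \<beta> M) / eps_of \<beta>))\<rfloor> + 1"

definition delta_of :: "real \<Rightarrow> real \<Rightarrow> real" where
  "delta_of \<beta> M =
     max ((gamma_of \<beta> M + 1) / 2)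
         ((1 - 1 / (eps_of \<beta> * real (nstar \<beta> M))) powr (1 / real (nstar \<beta> M)))"

(* The sequence starts at index 1; the value at index 0 is a dummy that is never used. *)
primrec alpha_seq :: "real \<Rightarrow> nat \<Rightarrow> real" where
  "alpha_seq \<alpha>1 0 = \<alpha>1"
| "alpha_seq \<alpha>1 (Suc n) = (if n = 0 then \<alpha>1 else delta_of (alpha_seq \<alpha>1 n) (real n))"

definition eps_seq :: "real \<Rightarrow> nat \<Rightarrow> real" where
  "eps_seq \<alpha>1 n = eps_of (alpha_seq \<alpha>1 n)"

definition N_seq :: "real \<Rightarrow> nat \<Rightarrow> nat" where
  "N_seq \<alpha>1 n = nstar (alpha_seq \<alpha>1 n) (real n)"

(* Decision processes with a single action and deterministic transitions. As there is only one
   action, the kernel q and the cost c depend on the state alone; pmf (q x) y is q(y|x), and the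
   successor of x is the state that q reaches from x with probability one. *)
primrec trajectory :: "('s \<Rightarrow> 's pmf) \<Rightarrow> 's \<Rightarrow> nat \<Rightarrow> 's" where
  "trajectory q x 0 = x"
| "trajectory q x (Suc t) = (THE y. pmf (q (trajectory q x t)) y = 1)"

(* Extended-real valued, so that for nonnegative costs the series, and the infimum and the
   supremum formed from it below, always have their proper value. *)
definition disc_cost :: "('s \<Rightarrow> 's pmf) \<Rightarrow> ('s \<Rightarrow> real) \<Rightarrow> real \<Rightarrow> 's \<Rightarrow> ereal" where
  "disc_cost q c \<alpha> x = (\<Sum>t. ereal (\<alpha> ^ t * c (trajectory q x t)))"

definition min_disc_cost :: "'s set \<Rightarrow> ('s \<Rightarrow> 's pmf) \<Rightarrow> ('s \<Rightarrow> real) \<Rightarrow> real \<Rightarrow> ereal" where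
  "min_disc_cost X q c \<alpha> = (INF x\<in>X. disc_cost q c \<alpha> x)"

definition rel_disc_cost :: "'s set \<Rightarrow> ('s \<Rightarrow> 's pmf) \<Rightarrow> ('s \<Rightarrow> real) \<Rightarrow> real \<Rightarrow> 's \<Rightarrow> ereal" where
  "rel_disc_cost X q c \<alpha> x = disc_cost q c \<alpha> x - min_disc_cost X q c \<alpha>"

definition assumption_B_underline :: "'s set \<Rightarrow> ('s \<Rightarrow> 's pmf) \<Rightarrow> ('s \<Rightarrow> real) \<Rightarrow> bool" where
  "assumption_B_underline X q c \<longleftrightarrow>
     (\<forall>x\<in>X. Liminf (at_left 1) (\<lambda>\<alpha>. rel_disc_cost X q c \<alpha> x) < \<infinity>)"

definition assumption_B :: "'s set \<Rightarrow> ('s \<Rightarrow> 's pmf) \<Rightarrow> ('s \<Rightarrow> real) \<Rightarrow> bool" where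
  "assumption_B X q c \<longleftrightarrow> (\<forall>x\<in>X. (SUP \<alpha>\<in>{0..<1}. rel_disc_cost X q c \<alpha> x) < \<infinity>)"

datatype state = Zero | Node nat nat

definition ex_states :: "real \<Rightarrow> state set" where
  "ex_states \<alpha>1 = {Zero} \<union> {Node n k | n k. 1 \<le> n \<and> 1 \<le> k \<and> k \<le> 2 * N_seq \<alpha>1 n}"

(* The values of the kernel and of the cost outside ex_states are irrelevant: no trajectory
   starting in ex_states leaves it. *)
definition ex_kernel :: "real \<Rightarrow> state \<Rightarrow> state pmf" where
  "ex_kernel \<alpha>1 x = (case x of
       Zero \<Rightarrow> return_pmf Zero
     | Node n k \<Rightarrow> if k < 2 * N_seq \<alpha>1 n then return_pmf (Node n (k + 1)) else return_pmf Zero)"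

definition ex_cost :: "real \<Rightarrow> state \<Rightarrow> real" where
  "ex_cost \<alpha>1 x = (case x of
       Zero \<Rightarrow> 1
     | Node n k \<Rightarrow> if k \<le> N_seq \<alpha>1 n then 1 - eps_seq \<alpha>1 n else 1 + eps_seq \<alpha>1 n)"

end

theory Submission
  imports Defs
begin

text \<open>
  Costs differ from 1 only along the finite path through a block of states \<open>Node n 1\<close>, \<dots>,
  \<open>Node n (2 * N\<^sub>n)\<close>, so every discounted cost is the baseline \<open>v\<^sub>\<alpha>(Zero) = 1 / (1 - \<alpha>)\<close> plus a
  finite perturbation. A block grants its rebate \<open>\<epsilon>\<^sub>n\<close> for \<open>N\<^sub>n\<close> steps and takes it back over the
  next \<open>N\<^sub>n\<close> steps, discounted more heavily; it is therefore most profitable to enter it at its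
  first state, which saves
  \<open>g\<^sub>n(\<alpha>) = \<epsilon>\<^sub>n * (1 - \<alpha> ^ N\<^sub>n) * (\<Sum>t<N\<^sub>n. \<alpha> ^ t) = \<epsilon>\<^sub>n * (1 - \<alpha> ^ N\<^sub>n)\<^sup>2 / (1 - \<alpha>)\<close>
  against the baseline. Hence \<open>m\<^sub>\<alpha> = 1 / (1 - \<alpha>) - (SUP n. g\<^sub>n(\<alpha>))\<close>. For a fixed state the
  perturbation stays bounded as \<open>\<alpha>\<close> varies, so both assumptions are questions about the size of
  \<open>SUP n. g\<^sub>n(\<alpha>)\<close>.

  Each saving is a bump in \<open>\<alpha>\<close>. At the discount factor \<open>\<gamma>\<close> of block \<open>n\<close> the choice of \<open>N\<^sub>n\<close> makes
  \<open>\<gamma> ^ N\<^sub>n \<le> 1 / 2\<close>, while \<open>1 - \<gamma> \<le> \<epsilon>\<^sub>n / (3 * n)\<close>; so the bump is at least \<open>3 * n / 4\<close> high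
  (\<open>gain_gamma_of_ge\<close>), and the bumps together are unbounded, which refutes Assumption B.
  But the bumps are separated by the points \<open>\<alpha>\<^sub>n\<close>, which tend to 1. A bump whose block comes
  later is still at most 1 at \<open>\<alpha>\<^sub>n\<close>, because \<open>g\<^sub>m(\<alpha>) \<le> \<epsilon>\<^sub>m / (1 - \<alpha>)\<close> and
  \<open>\<epsilon>\<^sub>m = 1 - \<alpha>\<^sub>m \<le> 1 - \<alpha>\<^sub>n\<close> (\<open>gain_le_early\<close>). A bump whose block comes earlier is again at most 1,
  because \<open>g\<^sub>m(\<alpha>) \<le> \<epsilon>\<^sub>m * N\<^sub>m * (1 - \<alpha> ^ N\<^sub>m)\<close> and \<open>\<delta>\<close> is chosen to make this at most 1 from there on
  (\<open>gain_le_late\<close>). So along \<open>\<alpha>\<^sub>n\<close> the minimal cost is within 1 of the baseline, which bounds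
  the lower limit in the weaker assumption from above.
\<close>

section \<open>Discounted costs of the block process\<close>

lemma trajectory_return_pmf_Suc:
  assumes "q (trajectory q x t) = return_pmf y"
  shows "trajectory q x (Suc t) = y"
  using assms by (auto simp: pmf_return indicator_def intro!: the_equality split: if_splits)

lemma trajectory_ex_Zero: "trajectory (ex_kernel \<alpha>1) Zero t = Zero"
proof (induction t)
  case (Suc t)
  then show ?case by (intro trajectory_return_pmf_Suc) (simp add: ex_kernel_def)
qed simp

lemma trajectory_ex_Node:
  assumes "k \<le> 2 * N_seq \<alpha>1 n"
  shows "trajectory (ex_kernel \<alpha>1) (Node n k) t =
           (if k + t \<le> 2 * N_seq \<alpha>1 n then Node n (k + t) else Zero)"
proof (induction t)
  case 0
  then show ?case using assms by simp
next
  case (Suc t)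
  then show ?case by (intro trajectory_return_pmf_Suc) (auto simp: ex_kernel_def)
qed

text \<open>
  Splitting off the geometric series leaves a finite sum. All later estimates concern this real
  number, so the extended-real series does not occur in them.
\<close>
lemma disc_cost_eventually_one:
  assumes \<alpha>: "0 \<le> \<alpha>" "\<alpha> < 1"
    and one: "\<And>t. L \<le> t \<Longrightarrow> c (trajectory q x t) = 1"
  shows "disc_cost q c \<alpha> x =
           ereal (1 / (1 - \<alpha>) + (\<Sum>t<L. \<alpha> ^ t * (c (trajectory q x t) - 1)))"
proof -
  let ?d = "\<lambda>t. \<alpha> ^ t * (c (trajectory q x t) - 1)"
  have "?d sums (\<Sum>t<L. ?d t)"
    by (rule sums_finite) (auto simp: one)
  moreover have "(\<lambda>t. \<alpha> ^ t) sums (1 / (1 - \<alpha>))"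
    using \<alpha> by (intro geometric_sums) auto
  ultimately have "(\<lambda>t. \<alpha> ^ t + ?d t) sums (1 / (1 - \<alpha>) + (\<Sum>t<L. ?d t))"
    by (intro sums_add)
  then have "(\<lambda>t. \<alpha> ^ t * c (trajectory q x t)) sums (1 / (1 - \<alpha>) + (\<Sum>t<L. ?d t))"
    by (simp add: algebra_simps)
  then show ?thesis
    unfolding disc_cost_def by (intro sums_unique[symmetric]) (simp add: sums_ereal)
qed

lemma disc_cost_ex_Zero:
  assumes "0 \<le> \<alpha>" "\<alpha> < 1"
  shows "disc_cost (ex_kernel \<alpha>1) (ex_cost \<alpha>1) \<alpha> Zero = ereal (1 / (1 - \<alpha>))"
  using disc_cost_eventually_one[of \<alpha> 0 "ex_cost \<alpha>1" "ex_kernel \<alpha>1" Zero] assms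
  by (simp add: trajectory_ex_Zero ex_cost_def)

text \<open>
  The last summand belongs to the final state of the block, of index \<open>k + t = 2 * N\<close>.
\<close>
lemma disc_cost_ex_Node:
  assumes "0 \<le> \<alpha>" "\<alpha> < 1" "k \<le> 2 * N_seq \<alpha>1 n"
  shows "disc_cost (ex_kernel \<alpha>1) (ex_cost \<alpha>1) \<alpha> (Node n k) =
    ereal (1 / (1 - \<alpha>) + (\<Sum>t<2 * N_seq \<alpha>1 n + 1 - k.
             \<alpha> ^ t * (if k + t \<le> N_seq \<alpha>1 n then - eps_seq \<alpha>1 n else eps_seq \<alpha>1 n)))"
  (is "_ = ereal (_ + ?S)")
proof -
  have "disc_cost (ex_kernel \<alpha>1) (ex_cost \<alpha>1) \<alpha> (Node n k) =
    ereal (1 / (1 - \<alpha>) + (\<Sum>t<2 * N_seq \<alpha>1 n + 1 - k.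
             \<alpha> ^ t * (ex_cost \<alpha>1 (trajectory (ex_kernel \<alpha>1) (Node n k) t) - 1)))"
    using assms by (intro disc_cost_eventually_one) (auto simp: trajectory_ex_Node ex_cost_def)
  also have "(\<Sum>t<2 * N_seq \<alpha>1 n + 1 - k.
             \<alpha> ^ t * (ex_cost \<alpha>1 (trajectory (ex_kernel \<alpha>1) (Node n k) t) - 1)) = ?S"
    using assms by (intro sum.cong) (auto simp: trajectory_ex_Node ex_cost_def)
  finally show ?thesis .
qed

section \<open>Savings from a block\<close>

text \<open>
  The saving against the baseline obtained by entering a block at its first state. This product
  form, unlike the quotient by \<open>1 - \<alpha>\<close>, lets the geometric sum be bounded by \<open>N\<close>.
\<close>
definition gain :: "real \<Rightarrow> nat \<Rightarrow> real \<Rightarrow> real" where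
  "gain \<epsilon> N \<alpha> = \<epsilon> * (1 - \<alpha> ^ N) * (\<Sum>t<N. \<alpha> ^ t)"

lemma sum_block_eq:
  fixes \<alpha> \<epsilon> :: real
  assumes "1 \<le> k" "k \<le> N"
  shows "(\<Sum>t<2 * N + 1 - k. \<alpha> ^ t * (if k + t \<le> N then - \<epsilon> else \<epsilon>)) =
           \<epsilon> * (\<alpha> ^ (N + 1 - k) * (\<Sum>t<N. \<alpha> ^ t) - (\<Sum>t<N + 1 - k. \<alpha> ^ t))"
proof -
  define j where "j = N + 1 - k"
  have less: "k + t \<le> N \<longleftrightarrow> t < j" for t
    using assms by (auto simp: j_def)
  have "{..<2 * N + 1 - k} = {..<j + N}"
    using assms by (auto simp: j_def)
  then have "(\<Sum>t<2 * N + 1 - k. \<alpha> ^ t * (if k + t \<le> N then - \<epsilon> else \<epsilon>)) =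
      (\<Sum>t<j + N. \<alpha> ^ t * (if t < j then - \<epsilon> else \<epsilon>))"
    by (simp add: less)
  also have "\<dots> = (\<Sum>t<j. \<alpha> ^ t * (if t < j then - \<epsilon> else \<epsilon>)) +
      (\<Sum>t<N. \<alpha> ^ (j + t) * (if j + t < j then - \<epsilon> else \<epsilon>))"
    by (induction N) (simp_all)
  also have "(\<Sum>t<j. \<alpha> ^ t * (if t < j then - \<epsilon> else \<epsilon>)) = - \<epsilon> * (\<Sum>t<j. \<alpha> ^ t)"
    by (simp add: sum_distrib_left sum_negf algebra_simps)
  also have "(\<Sum>t<N. \<alpha> ^ (j + t) * (if j + t < j then - \<epsilon> else \<epsilon>)) = \<epsilon> * \<alpha> ^ j * (\<Sum>t<N. \<alpha> ^ t)"
    by (simp add: sum_distrib_left power_add algebra_simps)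
  finally show ?thesis
    by (simp add: j_def algebra_simps)
qed

text \<open>
  Entering at the first state is optimal. With \<open>j = N + 1 - k\<close> rebates left, the perturbation is
  \<open>\<epsilon> * (\<alpha> ^ j * S N - S j)\<close> for the geometric sums \<open>S\<close>; since \<open>\<alpha> ^ j\<close> decreases and \<open>S j\<close>
  increases in \<open>j\<close>, it is smallest at \<open>j = N\<close>. Once no rebate is left it is nonnegative.
\<close>
lemma sum_block_ge_neg_gain:
  fixes \<alpha> \<epsilon> :: real
  assumes \<alpha>: "0 \<le> \<alpha>" "\<alpha> \<le> 1" and \<epsilon>: "0 \<le> \<epsilon>" and k: "1 \<le> k"
  shows "- gain \<epsilon> N \<alpha> \<le> (\<Sum>t<2 * N + 1 - k. \<alpha> ^ t * (if k + t \<le> N then - \<epsilon> else \<epsilon>))"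
proof (cases "k \<le> N")
  case True
  have "\<alpha> ^ N * (\<Sum>t<N. \<alpha> ^ t) \<le> \<alpha> ^ (N + 1 - k) * (\<Sum>t<N. \<alpha> ^ t)"
    using \<alpha> k by (intro mult_right_mono power_decreasing sum_nonneg) auto
  moreover have "(\<Sum>t<N + 1 - k. \<alpha> ^ t) \<le> (\<Sum>t<N. \<alpha> ^ t)"
    using \<alpha> k by (intro sum_mono2) auto
  ultimately have "\<epsilon> * (\<alpha> ^ N * (\<Sum>t<N. \<alpha> ^ t) - (\<Sum>t<N. \<alpha> ^ t)) \<le>
      \<epsilon> * (\<alpha> ^ (N + 1 - k) * (\<Sum>t<N. \<alpha> ^ t) - (\<Sum>t<N + 1 - k. \<alpha> ^ t))"
    using \<epsilon> by (intro mult_left_mono) linarith+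
  then show ?thesis
    unfolding sum_block_eq[OF k True] gain_def by (simp add: algebra_simps)
next
  case False
  then have "0 \<le> (\<Sum>t<2 * N + 1 - k. \<alpha> ^ t * (if k + t \<le> N then - \<epsilon> else \<epsilon>))"
    using \<alpha> \<epsilon> by (intro sum_nonneg) auto
  moreover have "0 \<le> gain \<epsilon> N \<alpha>"
    unfolding gain_def using \<alpha> \<epsilon> by (intro mult_nonneg_nonneg sum_nonneg) (auto simp: power_le_one)
  ultimately show ?thesis by linarith
qed

lemma gain_closed_form:
  assumes "\<alpha> \<noteq> 1"
  shows "gain \<epsilon> N \<alpha> = \<epsilon> * (1 - \<alpha> ^ N)\<^sup>2 / (1 - \<alpha>)"
proof -
  have "(\<Sum>t<N. \<alpha> ^ t) = (1 - \<alpha> ^ N) / (1 - \<alpha>)"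
    using assms by (simp add: sum_gp_strict)
  then show ?thesis by (simp add: gain_def power2_eq_square)
qed

text \<open>
  For a discount factor of at most \<open>1 - \<epsilon>\<close> even an everlasting rebate, worth \<open>\<epsilon> / (1 - \<alpha>)\<close>,
  would save at most 1.
\<close>
lemma gain_le_early:
  assumes "0 \<le> \<alpha>" "\<alpha> < 1" "0 \<le> \<epsilon>" "\<epsilon> \<le> 1 - \<alpha>"
  shows "gain \<epsilon> N \<alpha> \<le> 1"
proof -
  have "(1 - \<alpha> ^ N)\<^sup>2 \<le> 1"
    using assms by (intro power_le_one) (auto simp: power_le_one)
  then have "\<epsilon> * (1 - \<alpha> ^ N)\<^sup>2 \<le> (1 - \<alpha>) * 1"
    using assms by (intro mult_mono) auto
  then show ?thesis using assms by (simp add: gain_closed_form)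
qed

text \<open>
  For \<open>\<alpha>\<close> near 1 discounting hardly separates the rebates from the surcharges: of the total rebate,
  at most \<open>\<epsilon> * N\<close>, only the fraction \<open>1 - \<alpha> ^ N\<close> is not taken back.
\<close>
lemma gain_le_late:
  assumes "0 \<le> \<alpha>" "\<alpha> \<le> 1" "0 < \<epsilon>" "0 < N" "1 - 1 / (\<epsilon> * N) \<le> \<alpha> ^ N"
  shows "gain \<epsilon> N \<alpha> \<le> 1"
proof -
  have "(\<Sum>t<N. \<alpha> ^ t) \<le> (\<Sum>t<N. 1)"
    using assms by (intro sum_mono power_le_one)
  then have S: "(\<Sum>t<N. \<alpha> ^ t) \<le> N" by simp
  have "gain \<epsilon> N \<alpha> \<le> \<epsilon> * (1 / (\<epsilon> * N)) * N"
    unfolding gain_def using assms S by (intro mult_mono sum_nonneg) (auto simp: power_le_one)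
  also have "\<dots> = 1" using assms by simp
  finally show ?thesis .
qed

section \<open>The parameters of a single block\<close>

context
  fixes \<beta> M :: real
  assumes \<beta>: "0 < \<beta>" "\<beta> < 1" and M: "1 \<le> M"
begin

lemma gamma_of_bounds:
  shows "0 < gamma_of \<beta> M" "gamma_of \<beta> M < 1"
    and "3 * M * (1 - gamma_of \<beta> M) \<le> eps_of \<beta>"
    and "2 * (1 - gamma_of \<beta> M) \<le> 1 - \<beta>"
proof -
  have "0 < eps_of \<beta> / (3 * M)" using \<beta> M by (simp add: eps_of_def)
  then show "gamma_of \<beta> M < 1" using \<beta> by (simp add: gamma_of_def)
  have "(\<beta> + 1) / 2 \<le> gamma_of \<beta> M" by (simp add: gamma_of_def)
  then show "0 < gamma_of \<beta> M" "2 * (1 - gamma_of \<beta> M) \<le> 1 - \<beta>"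
    using \<beta> by argo+
  have "1 - gamma_of \<beta> M \<le> eps_of \<beta> / (3 * M)" by (simp add: gamma_of_def)
  then show "3 * M * (1 - gamma_of \<beta> M) \<le> eps_of \<beta>"
    using M by (simp add: pos_le_divide_eq mult.commute)
qed

text \<open>
  \<open>nstar\<close> exceeds the logarithm of a number \<open>a \<le> 1 / 2\<close>, and powers of \<open>\<gamma> < 1\<close> decrease.
\<close>
lemma gamma_of_power_nstar: "gamma_of \<beta> M ^ nstar \<beta> M \<le> 1 / 2"
proof -
  let ?\<gamma> = "gamma_of \<beta> M" and ?N = "nstar \<beta> M"
  define a where "a = min (1 / 2) (M * (1 - ?\<gamma>) / eps_of \<beta>)"
  have a: "0 < a" "a \<le> 1 / 2"
    using gamma_of_bounds \<beta> M by (auto simp: a_def eps_of_def)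
  have "log ?\<gamma> a \<le> ?N"
    unfolding nstar_def a_def[symmetric] by linarith
  then have "?\<gamma> powr ?N \<le> ?\<gamma> powr log ?\<gamma> a"
    using gamma_of_bounds by (intro powr_mono') auto
  also have "\<dots> = a" using gamma_of_bounds a by simp
  finally show ?thesis using a gamma_of_bounds by (simp add: powr_realpow)
qed

text \<open>
  This makes the base \<open>1 - 1 / (\<epsilon> * N)\<close> of the root in \<open>delta_of\<close> positive, so that this root is a
  genuine one. The reason is that halving by powers of \<open>\<gamma>\<close> takes long: by Bernoulli's inequality
  \<open>\<gamma> ^ N \<le> 1 / 2\<close> forces \<open>N * (1 - \<gamma>) \<ge> 1 / 2\<close>, whereas \<open>1 - \<gamma> \<le> \<epsilon> / 3\<close>; together
  they even give \<open>\<epsilon> * N \<ge> 3 / 2\<close>.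
\<close>
lemma one_less_eps_nstar: "1 < eps_of \<beta> * nstar \<beta> M"
proof -
  let ?\<gamma> = "gamma_of \<beta> M" and ?N = "nstar \<beta> M"
  have "1 - ?N * (1 - ?\<gamma>) \<le> ?\<gamma> ^ ?N"
    using Bernoulli_inequality[of "?\<gamma> - 1" ?N] gamma_of_bounds by (simp add: algebra_simps)
  then have "1 \<le> 2 * (?N * (1 - ?\<gamma>))" using gamma_of_power_nstar by linarith
  moreover have "3 * (?N * (1 - ?\<gamma>)) \<le> eps_of \<beta> * ?N"
  proof -
    have "3 * 1 * (1 - ?\<gamma>) \<le> 3 * M * (1 - ?\<gamma>)"
      using M gamma_of_bounds by (intro mult_right_mono mult_left_mono) auto
    then have "3 * (1 - ?\<gamma>) \<le> eps_of \<beta>"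
      using gamma_of_bounds by linarith
    then have "3 * (1 - ?\<gamma>) * ?N \<le> eps_of \<beta> * ?N"
      by (rule mult_right_mono) simp
    then show ?thesis by (simp add: algebra_simps)
  qed
  ultimately show ?thesis by linarith
qed

text \<open>
  At \<open>\<gamma>\<close> discounting separates the two halves of the block: the later half counts at most half as
  much as the earlier one. So \<open>(1 - \<gamma> ^ N)\<^sup>2 \<ge> 1 / 4\<close>, and the factor \<open>\<epsilon> / (1 - \<gamma>)\<close> is
  at least \<open>3 * M\<close>.
\<close>
lemma gain_gamma_of_ge: "3 * M / 4 \<le> gain (eps_of \<beta>) (nstar \<beta> M) (gamma_of \<beta> M)"
proof -
  let ?\<gamma> = "gamma_of \<beta> M" and ?N = "nstar \<beta> M"
  have "(1 / 2)\<^sup>2 \<le> (1 - ?\<gamma> ^ ?N)\<^sup>2"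
    using gamma_of_power_nstar by (intro power_mono) auto
  then have "3 * M * (1 - ?\<gamma>) * (1 / 2)\<^sup>2 \<le> eps_of \<beta> * (1 - ?\<gamma> ^ ?N)\<^sup>2"
    using gamma_of_bounds \<beta> by (intro mult_mono) (auto simp: eps_of_def)
  then show ?thesis
    using gamma_of_bounds by (simp add: gain_closed_form field_simps power2_eq_square)
qed

text \<open>
  The second bound makes the gaps \<open>1 - \<alpha>\<^sub>n\<close> shrink geometrically; the third is the
  hypothesis of \<open>gain_le_late\<close>, which is what the root in \<open>delta_of\<close> is designed for.
\<close>
lemma delta_of_bounds:
  shows "delta_of \<beta> M < 1"
    and "4 * (1 - delta_of \<beta> M) \<le> 1 - \<beta>"
    and "1 - 1 / (eps_of \<beta> * nstar \<beta> M) \<le> delta_of \<beta> M ^ nstar \<beta> M"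
proof -
  let ?N = "nstar \<beta> M"
  define b where "b = 1 - 1 / (eps_of \<beta> * ?N)"
  have N: "0 < ?N" by (simp add: nstar_def)
  have "0 < eps_of \<beta> * ?N" using one_less_eps_nstar by linarith
  then have b: "0 < b" "b < 1" using one_less_eps_nstar by (simp_all add: b_def)
  have "b powr (1 / ?N) < 1 powr (1 / ?N)"
    using b N by (intro powr_less_mono2) auto
  then show "delta_of \<beta> M < 1"
    using gamma_of_bounds by (simp add: delta_of_def b_def)
  have "(gamma_of \<beta> M + 1) / 2 \<le> delta_of \<beta> M" by (simp add: delta_of_def)
  then show "4 * (1 - delta_of \<beta> M) \<le> 1 - \<beta>"
    using gamma_of_bounds(4) by argo
  have "b = (b powr (1 / ?N)) ^ ?N"
    using b N by (simp add: powr_powr flip: powr_realpow)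
  also have "\<dots> \<le> delta_of \<beta> M ^ ?N"
    by (intro power_mono) (simp_all add: delta_of_def b_def)
  finally show "1 - 1 / (eps_of \<beta> * ?N) \<le> delta_of \<beta> M ^ ?N" by (simp add: b_def)
qed

end

section \<open>Bounded savings along the constructed sequence\<close>

text \<open>
  A lower limit only sees the best approach to the limit point, so it can be bounded along a single
  sequence.
\<close>
lemma Liminf_le_along_sequence:
  fixes f :: "'a \<Rightarrow> 'b :: complete_lattice"
  assumes "filterlim s F sequentially" and "\<And>n::nat. 1 \<le> n \<Longrightarrow> f (s n) \<le> C"
  shows "Liminf F f \<le> C"
proof (rule Liminf_least)
  fix P assume "eventually P F"
  then have "eventually (\<lambda>n. P (s n)) sequentially"
    using assms(1) by (simp add: filterlim_iff)
  then obtain n where "1 \<le> n" "P (s n)"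
    unfolding eventually_sequentially by (meson le_add1 le_add2)
  then show "(INF x\<in>Collect P. f x) \<le> C"
    using assms(2) by (intro INF_lower2[of "s n"]) auto
qed

context
  fixes \<alpha>1 :: real
  assumes \<alpha>1: "1 / 2 \<le> \<alpha>1" "\<alpha>1 < 1"
begin

lemma alpha_seq_bounds: "0 < alpha_seq \<alpha>1 n \<and> alpha_seq \<alpha>1 n < 1"
proof (induction n)
  case (Suc n)
  then show ?case
    using \<alpha>1 delta_of_bounds[of "alpha_seq \<alpha>1 n" n] by auto
qed (use \<alpha>1 in simp)

lemma eps_seq_bounds: "0 < eps_seq \<alpha>1 n" "eps_seq \<alpha>1 n < 1"
  using alpha_seq_bounds[of n] by (auto simp: eps_seq_def eps_of_def)

lemma one_minus_alpha_seq_Suc: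
  assumes "1 \<le> n"
  shows "4 * (1 - alpha_seq \<alpha>1 (Suc n)) \<le> 1 - alpha_seq \<alpha>1 n"
  using delta_of_bounds(2)[of "alpha_seq \<alpha>1 n" n] alpha_seq_bounds[of n] assms by simp

lemma alpha_seq_mono: "mono (alpha_seq \<alpha>1)"
proof (rule mono_iff_le_Suc[THEN iffD2], intro allI)
  fix n
  show "alpha_seq \<alpha>1 n \<le> alpha_seq \<alpha>1 (Suc n)"
  proof (cases "n = 0")
    case False
    then have "1 \<le> n" by simp
    from one_minus_alpha_seq_Suc[OF this] show ?thesis
      using alpha_seq_bounds[of "Suc n"] by argo
  qed simp
qed

lemma filterlim_alpha_seq: "filterlim (alpha_seq \<alpha>1) (at_left 1) sequentially"
proof -
  have le: "1 - alpha_seq \<alpha>1 (Suc n) \<le> (1 / 4) ^ n" for n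
  proof (induction n)
    case (Suc n)
    then show ?case using one_minus_alpha_seq_Suc[of "Suc n"] by simp
  qed (use \<alpha>1 in simp)
  have "(\<lambda>n. 1 - alpha_seq \<alpha>1 (Suc n)) \<longlonglongrightarrow> 0"
  proof (rule tendsto_sandwich[OF _ _ tendsto_const])
    show "(\<lambda>n. (1 / 4 :: real) ^ n) \<longlonglongrightarrow> 0" by (intro LIMSEQ_power_zero) simp
    show "\<forall>\<^sub>F n in sequentially. 1 - alpha_seq \<alpha>1 (Suc n) \<le> (1 / 4) ^ n" using le by simp
    show "\<forall>\<^sub>F n in sequentially. 0 \<le> 1 - alpha_seq \<alpha>1 (Suc n)"
      using alpha_seq_bounds by (intro always_eventually allI) (simp add: less_imp_le del: alpha_seq.simps)
  qed
  from tendsto_diff[OF tendsto_const[of 1] this] have "alpha_seq \<alpha>1 \<longlonglongrightarrow> 1"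
    by (simp add: filterlim_sequentially_Suc del: alpha_seq.simps)
  then show ?thesis
    using alpha_seq_bounds by (simp add: filterlim_at less_imp_neq)
qed

text \<open>
  At \<open>\<alpha>\<^sub>n\<close> the blocks \<open>m \<ge> n\<close> have rebates too small to matter yet, and for the blocks
  \<open>m < n\<close> the factor \<open>\<alpha>\<^sub>n \<ge> \<alpha>\<^bsub>m+1\<^esub> = \<delta>\<close> is already too close to 1.
\<close>
lemma gain_alpha_seq_le_1:
  assumes n: "1 \<le> n" and m: "1 \<le> m"
  shows "gain (eps_seq \<alpha>1 m) (N_seq \<alpha>1 m) (alpha_seq \<alpha>1 n) \<le> 1"
proof (cases "n \<le> m")
  case True
  then have "eps_seq \<alpha>1 m \<le> 1 - alpha_seq \<alpha>1 n"
    using monoD[OF alpha_seq_mono True] by (simp add: eps_seq_def eps_of_def)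
  then show ?thesis
    using alpha_seq_bounds[of n] eps_seq_bounds[of m] by (intro gain_le_early) auto
next
  case False
  let ?N = "N_seq \<alpha>1 m"
  have "1 - 1 / (eps_seq \<alpha>1 m * ?N) \<le> alpha_seq \<alpha>1 (Suc m) ^ ?N"
    using delta_of_bounds(3)[of "alpha_seq \<alpha>1 m" m] alpha_seq_bounds[of m] m
    by (simp add: eps_seq_def N_seq_def)
  also have "\<dots> \<le> alpha_seq \<alpha>1 n ^ ?N"
    using False alpha_seq_bounds[of "Suc m"] monoD[OF alpha_seq_mono, of "Suc m" n]
    by (intro power_mono) auto
  finally show ?thesis
    using alpha_seq_bounds[of n] eps_seq_bounds[of m]
    by (intro gain_le_late) (auto simp: N_seq_def nstar_def)
qed

lemma min_disc_cost_alpha_seq_ge: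
  assumes "1 \<le> n"
  shows "ereal (1 / (1 - alpha_seq \<alpha>1 n) - 1) \<le>
           min_disc_cost (ex_states \<alpha>1) (ex_kernel \<alpha>1) (ex_cost \<alpha>1) (alpha_seq \<alpha>1 n)"
  unfolding min_disc_cost_def
proof (rule INF_greatest)
  let ?\<alpha> = "alpha_seq \<alpha>1 n"
  have \<alpha>: "0 \<le> ?\<alpha>" "?\<alpha> < 1" using alpha_seq_bounds[of n] by auto
  fix x assume "x \<in> ex_states \<alpha>1"
  then consider "x = Zero"
    | m k where "x = Node m k" "1 \<le> m" "1 \<le> k" "k \<le> 2 * N_seq \<alpha>1 m"
    by (auto simp: ex_states_def)
  then show "ereal (1 / (1 - ?\<alpha>) - 1) \<le> disc_cost (ex_kernel \<alpha>1) (ex_cost \<alpha>1) ?\<alpha> x"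
  proof cases
    case 1
    then show ?thesis using disc_cost_ex_Zero[OF \<alpha>] by simp
  next
    case 2
    show ?thesis
      unfolding 2(1) disc_cost_ex_Node[OF \<alpha> 2(4)]
      using sum_block_ge_neg_gain[OF \<alpha>(1) less_imp_le[OF \<alpha>(2)] less_imp_le[OF eps_seq_bounds(1)] 2(3),
          of m "N_seq \<alpha>1 m"]
        gain_alpha_seq_le_1[OF assms 2(2)] by simp
  qed
qed

lemma disc_cost_ex_le:
  assumes x: "x \<in> ex_states \<alpha>1"
  obtains C where
    "\<And>\<alpha>. 0 \<le> \<alpha> \<Longrightarrow> \<alpha> < 1 \<Longrightarrow>
       disc_cost (ex_kernel \<alpha>1) (ex_cost \<alpha>1) \<alpha> x \<le> ereal (1 / (1 - \<alpha>) + C)"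
proof -
  from x consider "x = Zero" | n k where "x = Node n k" "k \<le> 2 * N_seq \<alpha>1 n"
    by (auto simp: ex_states_def)
  then show thesis
  proof cases
    case 1
    then show thesis using that[of 0] by (simp add: disc_cost_ex_Zero)
  next
    case 2
    let ?L = "2 * N_seq \<alpha>1 n + 1 - k"
    have "disc_cost (ex_kernel \<alpha>1) (ex_cost \<alpha>1) \<alpha> x \<le> ereal (1 / (1 - \<alpha>) + real ?L)"
      if \<alpha>: "0 \<le> \<alpha>" "\<alpha> < 1" for \<alpha>
    proof -
      have "(\<Sum>t<?L. \<alpha> ^ t * (if k + t \<le> N_seq \<alpha>1 n then - eps_seq \<alpha>1 n else eps_seq \<alpha>1 n))
              \<le> (\<Sum>t<?L. 1 * 1)"
        using \<alpha> eps_seq_bounds[of n]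
        by (intro sum_mono order_trans[OF mult_left_mono mult_right_mono]) (auto simp: power_le_one)
      then show ?thesis
        unfolding 2(1) disc_cost_ex_Node[OF \<alpha> 2(2)] by simp
    qed
    then show thesis by (rule that)
  qed
qed

lemma assumption_B_underline_ex:
  "assumption_B_underline (ex_states \<alpha>1) (ex_kernel \<alpha>1) (ex_cost \<alpha>1)"
  unfolding assumption_B_underline_def
proof
  fix x assume "x \<in> ex_states \<alpha>1"
  then obtain C where C: "\<And>\<alpha>. 0 \<le> \<alpha> \<Longrightarrow> \<alpha> < 1 \<Longrightarrow>
       disc_cost (ex_kernel \<alpha>1) (ex_cost \<alpha>1) \<alpha> x \<le> ereal (1 / (1 - \<alpha>) + C)"
    using disc_cost_ex_le by blast
  have "Liminf (at_left 1) (\<lambda>\<alpha>. rel_disc_cost (ex_states \<alpha>1) (ex_kernel \<alpha>1) (ex_cost \<alpha>1) \<alpha> x)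
          \<le> ereal (C + 1)"
  proof (rule Liminf_le_along_sequence[OF filterlim_alpha_seq])
    fix n :: nat assume n: "1 \<le> n"
    let ?\<alpha> = "alpha_seq \<alpha>1 n"
    have "rel_disc_cost (ex_states \<alpha>1) (ex_kernel \<alpha>1) (ex_cost \<alpha>1) ?\<alpha> x
            \<le> ereal (1 / (1 - ?\<alpha>) + C) - ereal (1 / (1 - ?\<alpha>) - 1)"
      unfolding rel_disc_cost_def
      using alpha_seq_bounds[of n] by (intro ereal_minus_mono C min_disc_cost_alpha_seq_ge n) auto
    then show "rel_disc_cost (ex_states \<alpha>1) (ex_kernel \<alpha>1) (ex_cost \<alpha>1) ?\<alpha> x \<le> ereal (C + 1)"
      by (simp add: algebra_simps)
  qed
  then show "Liminf (at_left 1) (\<lambda>\<alpha>. rel_disc_cost (ex_states \<alpha>1) (ex_kernel \<alpha>1) (ex_cost \<alpha>1) \<alpha> x) < \<infinity>"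
    using less_ereal.simps(4) order_le_less_trans by blast
qed

section \<open>Unbounded savings over all discount factors\<close>

text \<open>
  \<open>Zero\<close> pays the baseline, and \<open>Node n 1\<close> bounds the minimal cost from above.
\<close>
lemma gain_le_rel_disc_cost_Zero:
  assumes \<alpha>: "0 \<le> \<alpha>" "\<alpha> < 1" and n: "1 \<le> n"
  shows "ereal (gain (eps_seq \<alpha>1 n) (N_seq \<alpha>1 n) \<alpha>)
           \<le> rel_disc_cost (ex_states \<alpha>1) (ex_kernel \<alpha>1) (ex_cost \<alpha>1) \<alpha> Zero"
proof -
  let ?g = "gain (eps_seq \<alpha>1 n) (N_seq \<alpha>1 n) \<alpha>"
  have N: "1 \<le> N_seq \<alpha>1 n" by (simp add: N_seq_def nstar_def)
  have "Node n 1 \<in> ex_states \<alpha>1" using n N by (simp add: ex_states_def)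
  moreover have "disc_cost (ex_kernel \<alpha>1) (ex_cost \<alpha>1) \<alpha> (Node n 1) = ereal (1 / (1 - \<alpha>) - ?g)"
    using N by (subst disc_cost_ex_Node[OF \<alpha>]) (simp, subst sum_block_eq, simp_all add: gain_def algebra_simps)
  ultimately have "min_disc_cost (ex_states \<alpha>1) (ex_kernel \<alpha>1) (ex_cost \<alpha>1) \<alpha> \<le> ereal (1 / (1 - \<alpha>) - ?g)"
    unfolding min_disc_cost_def by (metis INF_lower)
  then have "ereal (1 / (1 - \<alpha>)) - ereal (1 / (1 - \<alpha>) - ?g)
      \<le> rel_disc_cost (ex_states \<alpha>1) (ex_kernel \<alpha>1) (ex_cost \<alpha>1) \<alpha> Zero"
    unfolding rel_disc_cost_def disc_cost_ex_Zero[OF \<alpha>] by (intro ereal_minus_mono) auto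
  then show ?thesis by simp
qed

text \<open>
  Already the state \<open>Zero\<close> violates the assumption. The discount factor has to follow the block:
  for a target \<open>B\<close> it is the number \<open>\<gamma>\<close> of a block with \<open>3 * n / 4 \<ge> B\<close>.
\<close>
lemma not_assumption_B_ex:
  "\<not> assumption_B (ex_states \<alpha>1) (ex_kernel \<alpha>1) (ex_cost \<alpha>1)"
proof
  let ?u = "\<lambda>\<alpha>. rel_disc_cost (ex_states \<alpha>1) (ex_kernel \<alpha>1) (ex_cost \<alpha>1) \<alpha> Zero"
  assume "assumption_B (ex_states \<alpha>1) (ex_kernel \<alpha>1) (ex_cost \<alpha>1)"
  then have "(SUP \<alpha>\<in>{0..<1}. ?u \<alpha>) \<noteq> \<infinity>"
    by (auto simp: assumption_B_def ex_states_def)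
  moreover have "(SUP \<alpha>\<in>{0..<1}. ?u \<alpha>) = \<infinity>"
  proof (rule ereal_top)
    fix B :: real
    obtain n :: nat where n: "max 1 (4 * B / 3) \<le> n" using real_arch_simple by blast
    let ?\<beta> = "alpha_seq \<alpha>1 n"
    let ?\<gamma> = "gamma_of ?\<beta> n"
    have \<gamma>: "0 \<le> ?\<gamma>" "?\<gamma> < 1"
      using gamma_of_bounds[of ?\<beta> n] alpha_seq_bounds[of n] n by auto
    have "B \<le> 3 * n / 4" using n by simp
    also have "\<dots> \<le> gain (eps_seq \<alpha>1 n) (N_seq \<alpha>1 n) ?\<gamma>"
      using gain_gamma_of_ge[of ?\<beta> n] alpha_seq_bounds[of n] n
      by (simp add: eps_seq_def N_seq_def)
    finally have "ereal B \<le> ereal (gain (eps_seq \<alpha>1 n) (N_seq \<alpha>1 n) ?\<gamma>)" by simp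
    also have "\<dots> \<le> ?u ?\<gamma>"
      using n by (intro gain_le_rel_disc_cost_Zero \<gamma>) simp
    also have "\<dots> \<le> (SUP \<alpha>\<in>{0..<1}. ?u \<alpha>)"
      using \<gamma> by (intro SUP_upper) simp
    finally show "ereal B \<le> (SUP \<alpha>\<in>{0..<1}. ?u \<alpha>)" .
  qed
  ultimately show False by simp
qed

end

theorem proposition4p2:
  fixes \<alpha>1 :: real
  assumes "1 / 2 \<le> \<alpha>1" and "\<alpha>1 < 1"
  shows "assumption_B_underline (ex_states \<alpha>1) (ex_kernel \<alpha>1) (ex_cost \<alpha>1) \<and>
         \<not> assumption_B (ex_states \<alpha>1) (ex_kernel \<alpha>1) (ex_cost \<alpha>1)"
  using assumption_B_underline_ex[OF assms] not_assumption_B_ex[OF assms] by blast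

end
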